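(* Let $A(s)=\sum_{n=1}^\infty a_n n^{-s}$ be a Dirichlet series that converges absolutely for $\Re(s)>\sigma$. Then for all real $x>0$, $\lambda>0$ and all complex $s$ with $\Re(s)>\sigma$, $$\sum_{n=1}^\infty a_n K_{i\lambda\log n}(x)\,n^{-s}=\frac{1}{2\lambda}\int_{-\infty}^{\infty}A(s+it)\,e^{-x\cosh(t/\lambda)}\,dt.$$
   Context: $K_\nu(z)$ is the Macdonald function (modified Bessel function of the second kind), $K_\nu(z)=\frac{\pi}{2}\frac{I_{-\nu}(z)-I_\nu(z)}{\sin\nu\pi}$ (with the limiting value for integer $\nu$), where $I_\nu(z)=\sum_{m=0}^\infty \frac{(z/2)^{\nu+2m}}{m!\,\Gamma(\nu+m+1)}$. *)

theory Defs
  imports "HOL-Analysis.Analysis"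
begin

text \<open>
  The modified Bessel function of the first kind of complex order \<open>\<nu>\<close>, on the principal branch.
  The entire function \<open>rGamma\<close> is the reciprocal of the Gamma function. As \<open>0 powr \<mu> = 0\<close> for
  every \<open>\<mu>\<close>, this is only meaningful for \<open>z \<noteq> 0\<close>.
\<close>
definition bessel_I :: "complex \<Rightarrow> complex \<Rightarrow> complex" where
  "bessel_I \<nu> z = (\<Sum>m. (z / 2) powr (\<nu> + 2 * of_nat m) * rGamma (\<nu> + of_nat m + 1) / fact m)"

definition macdonald_quotient :: "complex \<Rightarrow> complex \<Rightarrow> complex" where
  "macdonald_quotient \<nu> z =
     of_real pi / 2 * ((bessel_I (- \<nu>) z - bessel_I \<nu> z) / sin (\<nu> * of_real pi))"

definition bessel_K :: "complex \<Rightarrow> complex \<Rightarrow> complex" where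
  "bessel_K \<nu> z =
     (if \<nu> \<in> \<int> then Lim (at \<nu>) (\<lambda>\<mu>. macdonald_quotient \<mu> z) else macdonald_quotient \<nu> z)"

text \<open>
  Series over \<open>n \<ge> 1\<close> are written as sums over all natural numbers shifted by \<open>Suc\<close>, so the
  value \<open>a 0\<close> is irrelevant.
\<close>
definition dirichlet_term :: "(nat \<Rightarrow> complex) \<Rightarrow> complex \<Rightarrow> nat \<Rightarrow> complex" where
  "dirichlet_term a s n = a n * of_nat n powr (- s)"

definition dirichlet_series :: "(nat \<Rightarrow> complex) \<Rightarrow> complex \<Rightarrow> complex" where
  "dirichlet_series a s = (\<Sum>n. dirichlet_term a s (Suc n))"

end

theory Submission
  imports Defs "HOL-Real_Asymp.Real_Asymp"
begin

text \<open>
  Everything rests on the formula \<open>K\<^sub>\<nu>(x) = 1/2 \<integral> exp (\<nu> t - x cosh t) dt\<close> over the real line; given it, the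
  theorem follows by integrating the Dirichlet series term by term, since \<open>n\<close> to the power \<open>-it\<close>
  is \<open>exp (- i t ln n)\<close>. To relate the integral to the
  series defining \<open>I\<close>, write \<open>y = x\<^sup>2 / 4\<close> and \<open>I\<^sub>\<nu>(x) = (x / 2)\<^sup>\<nu> g\<^sub>\<nu>(y)\<close>. A translation of \<open>t\<close> by \<open>ln (x / 2)\<close> turns the
  integral into \<open>M\<^sub>\<nu>(y) = \<integral> exp (\<nu> t - exp t - y exp (-t)) dt\<close>, up to the factor \<open>(x / 2)\<^sup>\<nu>\<close>, and
  \<open>M\<^sub>\<nu>' = - M\<^sub>\<nu>\<^sub>-\<^sub>1\<close>. By the recurrences, \<open>y M\<^sub>\<nu> g\<^sub>\<nu>\<^sub>+\<^sub>1 + M\<^sub>\<nu>\<^sub>+\<^sub>1 g\<^sub>\<nu>\<close> has derivative \<open>0\<close>, and its limit at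
  \<open>y = 0\<close> is \<open>\<Gamma>(\<nu> + 1) / \<Gamma>(\<nu> + 1) = 1\<close>. The integral over \<open>t\<close> is even in \<open>\<nu>\<close>, so combining this relation for
  \<open>\<nu>\<close> and \<open>-\<nu>\<close> with the (likewise constant) Wronskian of \<open>I\<^sub>\<nu>\<close> and \<open>I\<^sub>-\<^sub>\<nu>\<close> gives the formula for
  non-integer \<open>\<nu>\<close> with \<open>\<bar>Re \<nu>\<bar> < 1\<close>. The case \<open>\<nu> = 0\<close>, needed for \<open>n = 1\<close>, follows by
  continuity.
\<close>

section \<open>The power series factor of the Bessel function I\<close>

text \<open>What remains of I once the multivalued factor (x / 2)^\<nu> is removed (the g of the
  overview), so that y = 0 becomes an ordinary point.\<close>

definition bessel_ser :: "complex \<Rightarrow> complex \<Rightarrow> complex" where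
  "bessel_ser \<nu> y = (\<Sum>m. rGamma (\<nu> + of_nat m + 1) / fact m * y ^ m)"

text \<open>Consecutive terms have ratio y / (c (m + 1)) with c = \<nu> + m + 1; the bound on
  \<open>Re \<nu>\<close> keeps c nonzero and its norm at least m.\<close>

lemma bessel_ser_summable:
  assumes "Re \<nu> > -1"
  shows "summable (\<lambda>m. rGamma (\<nu> + of_nat m + 1) / fact m * y ^ m)"
proof -
  \<comment> \<open>From m = N on, 2 |y| is at most m, which makes the ratio at most 1/2 in
    norm.\<close>
  obtain N :: nat where N: "2 * norm y \<le> real N" using real_arch_simple by blast
  show ?thesis
  proof (rule summable_ratio_test)
  fix m assume m: "N \<le> m"
  define c where "c = \<nu> + of_nat m + 1"
  have c: "norm c \<ge> real m"
    using complex_Re_le_cmod[of c] assms by (auto simp: c_def)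
  have c0: "c \<noteq> 0" using assms by (auto simp: c_def complex_eq_iff)
  have r: "rGamma (\<nu> + of_nat (Suc m) + 1) = rGamma c / c"
    using rGamma_plus1[of c] c0 by (simp add: c_def field_simps)
  have "norm y \<le> 1/2 * (norm c * (1 + real m))"
  proof -
    have "2 * norm y \<le> real m * 1" using N m by simp
    also have "\<dots> \<le> norm c * (1 + real m)" using c by (intro mult_mono) auto
    finally show ?thesis by simp
  qed
  hence q: "norm y / (norm c * (1 + real m)) \<le> 1/2"
    using c0 by (simp add: divide_le_eq mult_pos_pos add_pos_nonneg)
  have "norm (rGamma (\<nu> + of_nat (Suc m) + 1) / fact (Suc m) * y ^ Suc m)
       = norm y / (norm c * (1 + real m)) * norm (rGamma (\<nu> + of_nat m + 1) / fact m * y ^ m)"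
    unfolding r by (simp add: norm_mult norm_divide norm_power mult_ac norm_of_nat c_def del: of_nat_Suc)
  also have "\<dots> \<le> 1/2 * norm (rGamma (\<nu> + of_nat m + 1) / fact m * y ^ m)"
    using q by (intro mult_right_mono) auto
  finally show "norm (rGamma (\<nu> + of_nat (Suc m) + 1) / fact (Suc m) * y ^ Suc m)
     \<le> 1/2 * norm (rGamma (\<nu> + of_nat m + 1) / fact m * y ^ m)" .
  qed simp
qed

lemma bessel_ser_0: "bessel_ser \<nu> 0 = rGamma (\<nu> + 1)"
proof -
  have "bessel_ser \<nu> 0 = (\<Sum>m. (rGamma (\<nu> + of_nat m + 1) / fact m) * 0 ^ m)"
    by (simp add: bessel_ser_def)
  also have "\<dots> = rGamma (\<nu> + 1)" by (subst powser_zero) simp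
  finally show ?thesis .
qed

lemma bessel_ser_deriv:
  assumes "Re \<nu> > -1"
  shows "(bessel_ser \<nu> has_field_derivative bessel_ser (\<nu> + 1) y) (at y)"
proof -
  have "((\<lambda>y. \<Sum>m. rGamma (\<nu> + of_nat m + 1) / fact m * y ^ m) has_field_derivative
     (\<Sum>m. diffs (\<lambda>m. rGamma (\<nu> + of_nat m + 1) / fact m) m * y ^ m)) (at y)"
    by (rule termdiffs_strong_converges_everywhere) (rule bessel_ser_summable[OF assms])
  moreover have "diffs (\<lambda>m. rGamma (\<nu> + of_nat m + 1) / fact m) = (\<lambda>m. rGamma (\<nu> + 1 + of_nat m + 1) / fact m)"
    by (auto simp: diffs_def fun_eq_iff divide_simps simp del: of_nat_Suc) (simp add: add_ac)
  ultimately show ?thesis by (simp add: bessel_ser_def[abs_def])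
qed

text \<open>The three-term recurrence of I with the powers of x / 2 divided out. Coefficientwise,
  \<open>rGamma (\<nu> + m + 1)\<close> is (\<nu> + 1) + m times
  \<open>rGamma (\<nu> + m + 2)\<close>; the part \<nu> + 1 gives the first summand and the part m,
  after an index shift, the second.\<close>

lemma bessel_ser_rec:
  assumes "Re \<nu> > -1"
  shows "bessel_ser \<nu> y = (\<nu> + 1) * bessel_ser (\<nu> + 1) y + y * bessel_ser (\<nu> + 2) y"
proof -
  define f where "f \<mu> m = rGamma (\<mu> + of_nat m + 1) / fact m * y ^ m" for \<mu> m
  have s: "f \<nu> sums bessel_ser \<nu> y" "f (\<nu> + 1) sums bessel_ser (\<nu> + 1) y" "f (\<nu> + 2) sums bessel_ser (\<nu> + 2) y"
    unfolding f_def bessel_ser_def by (rule summable_sums, rule bessel_ser_summable, use assms in simp)+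
  have "(\<lambda>m. y * f (\<nu> + 2) m) sums (y * bessel_ser (\<nu> + 2) y)"
    by (intro sums_mult s)
  moreover have "y * f (\<nu> + 2) m = of_nat (Suc m) * f (\<nu> + 1) (Suc m)" for m
    by (simp add: f_def field_simps del: of_nat_Suc) (simp add: algebra_simps)
  ultimately have "(\<lambda>m. of_nat (Suc m) * f (\<nu> + 1) (Suc m)) sums (y * bessel_ser (\<nu> + 2) y)" by simp
  \<comment> \<open>The extra term at m = 0 vanishes because of its factor m.\<close>
  hence "(\<lambda>m. of_nat m * f (\<nu> + 1) m) sums (y * bessel_ser (\<nu> + 2) y)"
    by (subst (asm) sums_Suc_iff) simp
  hence "(\<lambda>m. (\<nu> + 1) * f (\<nu> + 1) m + of_nat m * f (\<nu> + 1) m) sums ((\<nu> + 1) * bessel_ser (\<nu> + 1) y + y * bessel_ser (\<nu> + 2) y)"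
    by (intro sums_add sums_mult s)
  moreover have "(\<nu> + 1) * f (\<nu> + 1) m + of_nat m * f (\<nu> + 1) m = f \<nu> m" for m
    unfolding f_def using rGamma_plus1[of "\<nu> + of_nat m + 1", symmetric] by (simp add: divide_simps) (simp add: algebra_simps)
  ultimately show ?thesis using s(1) sums_unique2 by simp
qed

lemma bessel_I_eq:
  assumes "x > 0" "Re \<nu> > -1"
  shows "bessel_I \<nu> (of_real x) = of_real (x / 2) powr \<nu> * bessel_ser \<nu> (of_real (x\<^sup>2 / 4))"
proof -
  have "(of_real x / 2) powr (\<nu> + 2 * of_nat m) * rGamma (\<nu> + of_nat m + 1) / fact m
     = of_real (x / 2) powr \<nu> * (rGamma (\<nu> + of_nat m + 1) / fact m * of_real (x\<^sup>2 / 4) ^ m)" for m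
  proof -
    have "(complex_of_real (x/2)) powr (2 * of_nat m) = of_real (x/2) powr of_nat (2 * m)" by simp
    also have "\<dots> = of_real (x\<^sup>2/4) ^ m"
      using assms(1) by (subst powr_nat') (auto simp: power_mult power2_eq_square)
    finally show ?thesis by (simp add: powr_add)
  qed
  thus ?thesis unfolding bessel_I_def bessel_ser_def
    by (subst suminf_mult [OF bessel_ser_summable[OF assms(2)], symmetric]) (simp only: of_real_divide of_real_numeral)
qed

lemma bessel_ser_cont:
  assumes "Re \<nu> > -1" shows "isCont (bessel_ser \<nu>) y"
  using DERIV_isCont[OF bessel_ser_deriv[OF assms]] .

text \<open>With y = x^2 / 4 the left-hand side is x times the Wronskian of I at orders \<nu> and
  -\<nu>. The recurrences make its derivative in y vanish, and the reflection formula evaluates it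
  at y = 0.\<close>

lemma bessel_ser_wronskian:
  assumes "\<bar>Re \<nu>\<bar> < 1"
  shows "2 * y * bessel_ser (\<nu> + 1) y * bessel_ser (-\<nu>) y
       - 2 * y * bessel_ser (1 - \<nu>) y * bessel_ser \<nu> y
       + 2 * \<nu> * bessel_ser \<nu> y * bessel_ser (-\<nu>) y = 2 * sin (of_real pi * \<nu>) / of_real pi"
proof -
  let ?W = "\<lambda>y. 2 * y * bessel_ser (\<nu> + 1) y * bessel_ser (-\<nu>) y
       - 2 * y * bessel_ser (1 - \<nu>) y * bessel_ser \<nu> y
       + 2 * \<nu> * bessel_ser \<nu> y * bessel_ser (-\<nu>) y"
  have d: "(bessel_ser \<nu> has_field_derivative bessel_ser (\<nu> + 1) y) (at y)"
          "(bessel_ser (\<nu> + 1) has_field_derivative bessel_ser (\<nu> + 2) y) (at y)"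
          "(bessel_ser (-\<nu>) has_field_derivative bessel_ser (1 - \<nu>) y) (at y)"
          "(bessel_ser (1-\<nu>) has_field_derivative bessel_ser (2 - \<nu>) y) (at y)" for y
    using bessel_ser_deriv[of \<nu> y] bessel_ser_deriv[of "\<nu>+1" y] bessel_ser_deriv[of "-\<nu>" y]
      bessel_ser_deriv[of "1-\<nu>" y] assms by (simp_all add: algebra_simps)
  have "(?W has_field_derivative 0) (at y within UNIV)" for y
    using bessel_ser_rec[of \<nu> y] bessel_ser_rec[of "-\<nu>" y] assms
    by (auto intro!: derivative_eq_intros d) (simp add: algebra_simps)
  then obtain c where c: "\<And>y. ?W y = c" 
    using has_field_derivative_zero_constant[of UNIV ?W] by auto
  have "c = 2 * \<nu> * rGamma (\<nu> + 1) * rGamma (1 - \<nu>)"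
    using c[of 0] by (simp add: bessel_ser_0)
  also have "\<dots> = 2 * rGamma \<nu> * rGamma (1 - \<nu>)" using rGamma_plus1[of \<nu>] by simp
  also have "\<dots> = 2 * inverse (Gamma \<nu> * Gamma (1 - \<nu>))" by (simp add: rGamma_inverse_Gamma)
  \<comment> \<open>This includes \<nu> = 0: there \<open>Gamma 0\<close> is 0 and sin is 0, so both
    sides are 0.\<close>
  also have "\<dots> = 2 * sin (of_real pi * \<nu>) / of_real pi" by (subst Gamma_reflection_complex) simp
  finally show ?thesis using c by simp
qed

section \<open>The integral M and its relation to the power series\<close>

text \<open>Under u = exp t this is the integrand of the integral of u^(\<nu> - 1) exp (-u - y / u)
  over u > 0. In the variable t, a change of order is just an exponential factor.\<close>

definition macdonald_integrand :: "complex \<Rightarrow> real \<Rightarrow> real \<Rightarrow> complex" where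
  "macdonald_integrand \<nu> y t = exp (\<nu> * of_real t - of_real (exp t + y * exp (- t)))"

definition macdonald_integral :: "complex \<Rightarrow> real \<Rightarrow> complex" where
  "macdonald_integral \<nu> y = (LINT t|lborel. macdonald_integrand \<nu> y t)"

lemma norm_macdonald_integrand:
  "norm (macdonald_integrand \<nu> y t) = exp (Re \<nu> * t - (exp t + y * exp (- t)))"
  by (simp add: macdonald_integrand_def)

lemma macdonald_integrand_measurable [measurable]:
  "macdonald_integrand \<nu> y \<in> borel_measurable borel"
  unfolding macdonald_integrand_def by (intro borel_measurable_continuous_onI continuous_intros)

lemma macdonald_integrand_shift:
  "macdonald_integrand (\<nu> + of_real b) y t = of_real (exp (b * t)) * macdonald_integrand \<nu> y t"
  by (simp add: macdonald_integrand_def exp_of_real [symmetric] exp_add [symmetric] algebra_simps)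

text \<open>
  At \<open>y = 0\<close> the substitution \<open>u = exp t\<close> turns the integral into Euler's integral for \<open>Gamma \<nu>\<close>.
\<close>

lemma macdonald_integral_0:
  assumes "Re \<nu> > 0"
  shows "integrable lborel (macdonald_integrand \<nu> 0)" "macdonald_integral \<nu> 0 = Gamma \<nu>"
proof -
  let ?f = "\<lambda>t. complex_of_real t powr (\<nu> - 1) / of_real (exp t)"
  have range_exp: "range exp = {0::real<..}"
    by (auto simp: image_iff) (metis exp_ln)
  have "?f absolutely_integrable_on range exp \<and> integral (range exp) ?f = Gamma \<nu>"
    using absolutely_integrable_Gamma_integral'[OF assms] Gamma_integral_complex'[OF assms]
    by (auto simp: range_exp intro!: integral_unique)
  hence "(\<lambda>t. \<bar>exp t\<bar> *\<^sub>R ?f (exp t)) absolutely_integrable_on UNIV \<and>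
     integral UNIV (\<lambda>t. \<bar>exp t\<bar> *\<^sub>R ?f (exp t)) = Gamma \<nu>"
    by (subst has_absolute_integral_change_of_variables_real)
       (auto intro!: derivative_eq_intros inj_onI)
  also have "(\<lambda>t. \<bar>exp t\<bar> *\<^sub>R ?f (exp t)) = macdonald_integrand \<nu> 0"
    by (auto simp: fun_eq_iff macdonald_integrand_def powr_def scaleR_conv_of_real exp_diff
        exp_of_real left_diff_distrib Ln_of_real simp flip: exp_of_real)
  finally have *: "integrable lebesgue (macdonald_integrand \<nu> 0)" "integral UNIV (macdonald_integrand \<nu> 0) = Gamma \<nu>"
    by (simp_all add: set_integrable_def)
  show i: "integrable lborel (macdonald_integrand \<nu> 0)"
    using *(1) by (subst (asm) integrable_completion) auto
  show "macdonald_integral \<nu> 0 = Gamma \<nu>"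
    using integral_lborel[OF i] * by (simp add: macdonald_integral_def)
qed

lemma exp_minus_le_power:
  fixes z :: real assumes "z > 0" shows "exp (- z) \<le> fact k / z ^ k"
proof -
  have "z ^ k / fact k \<le> exp z"
    using sum_le_suminf[OF summable_exp[of z], of "{k}"] assms
    by (simp add: exp_def divide_inverse mult.commute scaleR_conv_of_real)
  thus ?thesis using assms by (simp add: exp_minus field_simps)
qed

text \<open>Only the behaviour as t tends to minus infinity is delicate. There the decay of exp (-y
  exp (-t)) is traded for a power of exp t, which raises the order by k until its real part is
  positive and the Gamma integral at y = 0 is a majorant.\<close>

lemma macdonald_integrable:
  assumes "y > 0"
  shows "integrable lborel (macdonald_integrand \<nu> y)"
proof -
  obtain k :: nat where k: "- Re \<nu> < real k" using reals_Archimedean2 by blast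
  have "integrable lborel (\<lambda>t. fact k / y ^ k * norm (macdonald_integrand (\<nu> + of_nat k) 0 t))"
    using k by (intro integrable_mult_right integrable_norm macdonald_integral_0) auto
  thus ?thesis
  proof (rule Bochner_Integration.integrable_bound, goal_cases)
    case 2
    show ?case
    proof (intro AE_I2)
      fix t :: real
      have "norm (macdonald_integrand \<nu> y t) = exp (Re \<nu> * t - exp t) * exp (- (y * exp (- t)))"
        by (simp add: norm_macdonald_integrand flip: exp_add)
      also have "\<dots> \<le> exp (Re \<nu> * t - exp t) * (fact k / (y * exp (- t)) ^ k)"
        using assms by (intro mult_left_mono exp_minus_le_power) auto
      also have "\<dots> = fact k / y ^ k * norm (macdonald_integrand (\<nu> + of_nat k) 0 t)"
        using assms by (simp add: norm_macdonald_integrand power_mult_distrib exp_minus exp_diff exp_add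
            exp_of_nat2_mult field_simps)
      finally show "norm (macdonald_integrand \<nu> y t) \<le> norm (fact k / y ^ k * norm (macdonald_integrand (\<nu> + of_nat k) 0 t))"
        using assms by simp
    qed
  qed simp
qed

text \<open>Integration by parts: the t-derivative of the integrand is a combination of the
  integrands of orders \<nu>, \<nu> + 1 and \<nu> - 1, and its integral is 0 because the integrand
  vanishes at both ends.\<close>

lemma macdonald_integral_rec:
  assumes "y > 0"
  shows "\<nu> * macdonald_integral \<nu> y = macdonald_integral (\<nu> + 1) y - of_real y * macdonald_integral (\<nu> - 1) y"
proof -
  let ?f = "\<lambda>t. \<nu> * macdonald_integrand \<nu> y t - macdonald_integrand (\<nu> + 1) y t + of_real y * macdonald_integrand (\<nu> - 1) y t"
  have i: "integrable lborel ?f"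
    using macdonald_integrable[OF assms] by auto
  have d: "(macdonald_integrand \<nu> y has_vector_derivative ?f t) (at t)" for t
  proof -
    have "((\<lambda>z. exp (\<nu> * z - (exp z + of_real y * exp (- z)))) has_field_derivative 
       (\<nu> - (exp z - of_real y * exp (- z))) * exp (\<nu> * z - (exp z + of_real y * exp (- z)))) (at z)" for z
      by (auto intro!: derivative_eq_intros simp: algebra_simps)
    from has_vector_derivative_real_field[OF this[of "of_real t"], of UNIV]
    have "(macdonald_integrand \<nu> y has_vector_derivative 
       (\<nu> - (exp (of_real t) - of_real y * exp (- of_real t))) * macdonald_integrand \<nu> y t) (at t)"
      by (simp add: macdonald_integrand_def[abs_def] flip: exp_of_real)
    also have "(\<nu> - (exp (of_real t) - of_real y * exp (- of_real t))) * macdonald_integrand \<nu> y t = ?f t"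
      using macdonald_integrand_shift[of \<nu> 1 y t] macdonald_integrand_shift[of \<nu> "-1" y t]
      by (simp add: algebra_simps flip: exp_of_real)
    finally show ?thesis .
  qed
  have lim: "((macdonald_integrand \<nu> y) \<longlongrightarrow> 0) at_top" "((macdonald_integrand \<nu> y) \<longlongrightarrow> 0) at_bot"
    by (rule tendsto_norm_zero_cancel, unfold norm_macdonald_integrand, insert assms, real_asymp)+
  have "(LBINT t=-\<infinity>..\<infinity>. ?f t) = 0 - 0"
  proof (rule interval_integral_FTC_integrable)
    show "((macdonald_integrand \<nu> y \<circ> real_of_ereal) \<longlongrightarrow> 0) (at_right (- \<infinity>))"
         "((macdonald_integrand \<nu> y \<circ> real_of_ereal) \<longlongrightarrow> 0) (at_left \<infinity>)"
      using lim by (simp_all add: ereal_tendsto_simps)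
    show "isCont ?f x" for x
      unfolding macdonald_integrand_def by (intro continuous_intros)
  qed (use d i in \<open>auto simp: set_integrable_def\<close>)
  hence "(LINT t|lborel. ?f t) = 0"
    by (simp add: interval_lebesgue_integral_def set_lebesgue_integral_def)
  also have "(LINT t|lborel. ?f t) = \<nu> * macdonald_integral \<nu> y - macdonald_integral (\<nu> + 1) y + of_real y * macdonald_integral (\<nu> - 1) y"
    unfolding macdonald_integral_def using macdonald_integrable[OF assms] by simp
  finally show ?thesis by (simp add: algebra_simps)
qed

text \<open>Dominated convergence: the integrand decreases in norm as y grows, so the one at y = 0
  is a majorant.\<close>

lemma macdonald_integral_tendsto_0:
  assumes "Re \<nu> > 0"
  shows "((\<lambda>y. macdonald_integral \<nu> y) \<longlongrightarrow> Gamma \<nu>) (at_right 0)"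
  unfolding tendsto_at_iff_sequentially macdonald_integral_0(2)[OF assms, symmetric] macdonald_integral_def o_def
proof (intro allI impI)
  fix X assume X: "\<forall>i. X i \<in> {0<..} - {0::real}" "X \<longlonglongrightarrow> 0"
  show "(\<lambda>n. LINT t|lborel. macdonald_integrand \<nu> (X n) t) \<longlonglongrightarrow> (LINT t|lborel. macdonald_integrand \<nu> 0 t)"
  proof (rule integral_dominated_convergence)
    show "integrable lborel (\<lambda>t. norm (macdonald_integrand \<nu> 0 t))"
      by (intro integrable_norm macdonald_integral_0 assms)
    show "AE t in lborel. norm (macdonald_integrand \<nu> (X n) t) \<le> norm (macdonald_integrand \<nu> 0 t)" for n
      using X by (auto simp: norm_macdonald_integrand less_imp_le)
    show "AE t in lborel. (\<lambda>n. macdonald_integrand \<nu> (X n) t) \<longlonglongrightarrow> macdonald_integrand \<nu> 0 t"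
      unfolding macdonald_integrand_def by (intro AE_I2 tendsto_intros X)
  qed auto
qed

text \<open>Differentiation under the integral sign. For z > y / 2 the mean value inequality bounds
  the difference quotients by the integrand of order \<nu> - 1 at y / 2, which is integrable since y
  / 2 > 0.\<close>

lemma macdonald_integral_deriv:
  assumes "y > 0"
  shows "((\<lambda>y. macdonald_integral \<nu> y) has_vector_derivative - macdonald_integral (\<nu> - 1) y) (at y)"
proof -
  let ?q = "\<lambda>z t. (macdonald_integrand \<nu> z t - macdonald_integrand \<nu> y t) /\<^sub>R (z - y)"
  have eq: "macdonald_integrand \<nu> z t = exp (\<nu> * of_real t - of_real (exp t)) * of_real (exp (- z * exp (- t)))" for z t
    unfolding exp_of_real [symmetric] exp_add [symmetric] macdonald_integrand_def
    by (simp add: algebra_simps exp_of_real)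
  have lim: "((\<lambda>z. ?q z t) \<longlongrightarrow> - macdonald_integrand (\<nu> - 1) y t) (at y)" for t
  proof -
    have "((\<lambda>z. exp (- z * exp (- t))) has_real_derivative - exp (- t) * exp (- y * exp (- t))) (at y)"
      by (auto intro!: derivative_eq_intros)
    hence "((\<lambda>z. (exp (- z * exp (- t)) - exp (- y * exp (- t))) / (z - y)) \<longlongrightarrow> - exp (- t) * exp (- y * exp (- t))) (at y)"
      by (simp add: has_field_derivative_iff)
    hence "((\<lambda>z. exp (\<nu> * of_real t - of_real (exp t)) * of_real ((exp (- z * exp (- t)) - exp (- y * exp (- t))) / (z - y)))
       \<longlongrightarrow> exp (\<nu> * of_real t - of_real (exp t)) * of_real (- exp (- t) * exp (- y * exp (- t)))) (at y)"
      by (intro tendsto_intros)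
    also have "exp (\<nu> * of_real t - of_real (exp t)) * of_real (- exp (- t) * exp (- y * exp (- t))) = - macdonald_integrand (\<nu> - 1) y t"
      using macdonald_integrand_shift[of \<nu> "-1" y t] by (simp add: eq[of y])
    also have "(\<lambda>z. exp (\<nu> * of_real t - of_real (exp t)) * of_real ((exp (- z * exp (- t)) - exp (- y * exp (- t))) / (z - y)))
      = (\<lambda>z. ?q z t)"
      unfolding eq by (simp add: fun_eq_iff scaleR_conv_of_real divide_inverse algebra_simps)
    finally show ?thesis .
  qed
  have bound: "norm (?q z t) \<le> norm (macdonald_integrand (\<nu> - 1) (y / 2) t)" if z: "z > y / 2" for z t
  proof -
    have "norm (exp (- z * exp (- t)) - exp (- y * exp (- t))) \<le> exp (- t) * exp (- (y/2) * exp (- t)) * norm (z - y)"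
    proof (rule field_differentiable_bound[of "{y/2..}"])
      fix w assume "w \<in> {y/2..}"
      show "((\<lambda>z. exp (- z * exp (- t))) has_field_derivative - exp (- t) * exp (- w * exp (- t))) (at w within {y/2..})"
        by (auto intro!: derivative_eq_intros)
      show "norm (- exp (- t) * exp (- w * exp (- t))) \<le> exp (- t) * exp (- (y/2) * exp (- t))"
        using \<open>w \<in> {y/2..}\<close> by simp
    qed (use z assms in auto)
    hence "norm (macdonald_integrand \<nu> z t - macdonald_integrand \<nu> y t) 
       \<le> norm (exp (\<nu> * of_real t - of_real (exp t))) * (exp (- t) * exp (- (y/2) * exp (- t)) * norm (z - y))"
      unfolding eq by (simp add: norm_mult flip: right_diff_distrib of_real_diff)
    also have "\<dots> = norm (macdonald_integrand (\<nu> - 1) (y / 2) t) * norm (z - y)"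
      using macdonald_integrand_shift[of \<nu> "-1" "y/2" t] by (simp add: eq[of "y/2"] norm_mult)
    finally show ?thesis unfolding norm_scaleR by (cases "z = y") (auto simp: field_simps)
  qed
  have "((\<lambda>z. (macdonald_integral \<nu> z - macdonald_integral \<nu> y) /\<^sub>R (z - y)) \<longlongrightarrow> - macdonald_integral (\<nu> - 1) y) (at y within {y/2<..})"
    unfolding tendsto_at_iff_sequentially o_def
  proof (intro allI impI)
    fix X assume X: "\<forall>i. X i \<in> {y/2<..} - {y}" "X \<longlonglongrightarrow> y"
    have "(\<lambda>n. LINT t|lborel. ?q (X n) t) \<longlonglongrightarrow> (LINT t|lborel. - macdonald_integrand (\<nu> - 1) y t)"
    proof (rule integral_dominated_convergence)
      show "integrable lborel (\<lambda>t. norm (macdonald_integrand (\<nu> - 1) (y / 2) t))"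
        using assms by (intro integrable_norm macdonald_integrable) auto
      show "AE t in lborel. norm (?q (X n) t) \<le> norm (macdonald_integrand (\<nu> - 1) (y / 2) t)" for n
        using X bound by auto
      show "AE t in lborel. (\<lambda>n. ?q (X n) t) \<longlonglongrightarrow> - macdonald_integrand (\<nu> - 1) y t"
        using lim X unfolding tendsto_at_iff_sequentially o_def by auto
    qed measurable
    also have "(\<lambda>n. LINT t|lborel. ?q (X n) t) = (\<lambda>n. (macdonald_integral \<nu> (X n) - macdonald_integral \<nu> y) /\<^sub>R (X n - y))"
    proof
      fix n
      have "X n > 0" using X assms by (auto intro: less_trans[of 0 "y/2"])
      thus "(LINT t|lborel. ?q (X n) t) = (macdonald_integral \<nu> (X n) - macdonald_integral \<nu> y) /\<^sub>R (X n - y)"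
        using assms macdonald_integrable unfolding macdonald_integral_def by simp
    qed
    finally show "(\<lambda>n. (macdonald_integral \<nu> (X n) - macdonald_integral \<nu> y) /\<^sub>R (X n - y)) \<longlonglongrightarrow> - macdonald_integral (\<nu> - 1) y"
      by (simp add: macdonald_integral_def)
  qed
  moreover have "at y within {y/2<..} = at y" using assms by (intro at_within_open) auto
  ultimately have q: "((\<lambda>z. (macdonald_integral \<nu> z - macdonald_integral \<nu> y) /\<^sub>R (z - y)) \<longlongrightarrow> - macdonald_integral (\<nu> - 1) y) (at y)"
    by simp
  show ?thesis
    unfolding has_vector_derivative_def has_derivative_iff_norm
  proof (intro conjI bounded_linear_scaleR_left)
    have "((\<lambda>z. norm ((macdonald_integral \<nu> z - macdonald_integral \<nu> y) /\<^sub>R (z - y) - - macdonald_integral (\<nu> - 1) y)) \<longlongrightarrow> 0) (at y)"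
      using q by (intro tendsto_norm_zero) (simp only: LIM_zero_iff)
    moreover have "\<forall>\<^sub>F z in at y. norm ((macdonald_integral \<nu> z - macdonald_integral \<nu> y) /\<^sub>R (z - y) - - macdonald_integral (\<nu> - 1) y)
       = norm (macdonald_integral \<nu> z - macdonald_integral \<nu> y - (z - y) *\<^sub>R - macdonald_integral (\<nu> - 1) y) / norm (z - y)"
      unfolding eventually_at_filter
    proof (intro always_eventually allI impI)
      fix z assume "z \<noteq> y"
      hence "macdonald_integral \<nu> z - macdonald_integral \<nu> y - (z - y) *\<^sub>R - macdonald_integral (\<nu> - 1) y
        = (z - y) *\<^sub>R ((macdonald_integral \<nu> z - macdonald_integral \<nu> y) /\<^sub>R (z - y) - - macdonald_integral (\<nu> - 1) y)"
        by (simp add: scaleR_right_diff_distrib scaleR_add_right)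
      thus "norm ((macdonald_integral \<nu> z - macdonald_integral \<nu> y) /\<^sub>R (z - y) - - macdonald_integral (\<nu> - 1) y)
       = norm (macdonald_integral \<nu> z - macdonald_integral \<nu> y - (z - y) *\<^sub>R - macdonald_integral (\<nu> - 1) y) / norm (z - y)"
        using \<open>z \<noteq> y\<close> by (simp only: norm_scaleR) simp
    qed
    ultimately show "((\<lambda>z. norm (macdonald_integral \<nu> z - macdonald_integral \<nu> y - (z - y) *\<^sub>R - macdonald_integral (\<nu> - 1) y) / norm (z - y)) \<longlongrightarrow> 0) (at y)"
      by (rule Lim_transform_eventually)
  qed
qed

text \<open>
  With \<open>y = x\<^sup>2 / 4\<close> this is the Wronskian relation
  \<open>I\<^sub>\<nu>(x) K\<^sub>\<nu>\<^sub>+\<^sub>1(x) + I\<^sub>\<nu>\<^sub>+\<^sub>1(x) K\<^sub>\<nu>(x) = 1 / x\<close>,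
  with the integral in place of \<open>K\<close>.
\<close>

lemma macdonald_integral_bessel_ser:
  assumes "Re \<nu> > -1" "y > 0"
  shows "of_real y * macdonald_integral \<nu> y * bessel_ser (\<nu> + 1) (of_real y)
         + macdonald_integral (\<nu> + 1) y * bessel_ser \<nu> (of_real y) = 1"
proof -
  define W where "W y = of_real y * macdonald_integral \<nu> y * bessel_ser (\<nu> + 1) (of_real y)
         + macdonald_integral (\<nu> + 1) y * bessel_ser \<nu> (of_real y)" for y
  have "(W has_vector_derivative 0) (at y within {0<..})" if "y > 0" for y
  proof -
    have d: "((\<lambda>y. bessel_ser \<nu> (of_real y)) has_vector_derivative bessel_ser (\<nu> + 1) (of_real y)) (at y)"
      "((\<lambda>y. bessel_ser (\<nu> + 1) (of_real y)) has_vector_derivative bessel_ser (\<nu> + 2) (of_real y)) (at y)"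
      using bessel_ser_deriv[of \<nu> "of_real y"] bessel_ser_deriv[of "\<nu> + 1" "of_real y"] assms
      by (auto intro!: has_vector_derivative_real_field simp: add.assoc)
    have m: "(macdonald_integral \<nu> has_vector_derivative - macdonald_integral (\<nu> - 1) y) (at y)"
      "(macdonald_integral (\<nu> + 1) has_vector_derivative - macdonald_integral \<nu> y) (at y)"
      using macdonald_integral_deriv[OF that, of \<nu>] macdonald_integral_deriv[OF that, of "\<nu> + 1"] by simp_all
    have o: "((\<lambda>y. complex_of_real y) has_vector_derivative 1) (at y)"
      by (auto intro!: derivative_eq_intros)
    have "(W has_vector_derivative
        of_real y * macdonald_integral \<nu> y * bessel_ser (\<nu> + 2) (of_real y)
        + (of_real y * (- macdonald_integral (\<nu> - 1) y) + 1 * macdonald_integral \<nu> y) * bessel_ser (\<nu> + 1) (of_real y)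
        + (macdonald_integral (\<nu> + 1) y * bessel_ser (\<nu> + 1) (of_real y)
           + (- macdonald_integral \<nu> y) * bessel_ser \<nu> (of_real y))) (at y)"
      unfolding W_def[abs_def]
      by (intro has_vector_derivative_add has_vector_derivative_mult d m o)
    also have "of_real y * macdonald_integral \<nu> y * bessel_ser (\<nu> + 2) (of_real y)
        + (of_real y * (- macdonald_integral (\<nu> - 1) y) + 1 * macdonald_integral \<nu> y) * bessel_ser (\<nu> + 1) (of_real y)
        + (macdonald_integral (\<nu> + 1) y * bessel_ser (\<nu> + 1) (of_real y)
           + (- macdonald_integral \<nu> y) * bessel_ser \<nu> (of_real y)) = 0"
      using bessel_ser_rec[OF assms(1), of "of_real y"] macdonald_integral_rec[OF that, of \<nu>] by algebra
    finally show ?thesis by (rule has_vector_derivative_at_within)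
  qed
  then obtain c where c: "\<And>y. y > 0 \<Longrightarrow> W y = c"
    using has_vector_derivative_zero_constant[of "{0<..}" W] by (metis convex_real_interval(3) greaterThan_iff)
  have M1: "(macdonald_integral (\<nu> + 1) \<longlongrightarrow> Gamma (\<nu> + 1)) (at_right 0)"
    and M2: "(macdonald_integral (\<nu> + 2) \<longlongrightarrow> Gamma (\<nu> + 2)) (at_right 0)"
    using assms by (auto intro!: macdonald_integral_tendsto_0)
  have "((\<lambda>y. macdonald_integral (\<nu> + 2) y - (\<nu> + 1) * macdonald_integral (\<nu> + 1) y) \<longlongrightarrow>
         Gamma (\<nu> + 2) - (\<nu> + 1) * Gamma (\<nu> + 1)) (at_right 0)"
    by (intro tendsto_intros M1 M2)
  also have "\<nu> + 1 \<noteq> 0" using assms by (auto simp: complex_eq_iff)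
  hence "Gamma (\<nu> + 2) - (\<nu> + 1) * Gamma (\<nu> + 1) = 0"
    using Gamma_plus1[of "\<nu> + 1"] assms by (simp add: add.assoc nonpos_Ints_def complex_eq_iff)
  finally have "((\<lambda>y. of_real y * macdonald_integral \<nu> y) \<longlongrightarrow> 0) (at_right 0)"
  proof (rule Lim_transform_eventually)
    show "\<forall>\<^sub>F y in at_right 0. macdonald_integral (\<nu> + 2) y - (\<nu> + 1) * macdonald_integral (\<nu> + 1) y = of_real y * macdonald_integral \<nu> y"
      using eventually_at_right_less[of 0]
      by eventually_elim (simp add: macdonald_integral_rec[of _ "\<nu> + 1"] add.assoc)
  qed
  moreover have g: "((\<lambda>y. bessel_ser \<mu> (of_real y)) \<longlongrightarrow> bessel_ser \<mu> 0) (at_right 0)" if "Re \<mu> > -1" for \<mu>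
    using isCont_tendsto_compose[OF bessel_ser_cont[OF that], of of_real 0 "at_right 0"]
      tendsto_of_real[of "\<lambda>x. x" "0::real" "at_right 0"] by simp
  ultimately have "(W \<longlongrightarrow> 0 * bessel_ser (\<nu> + 1) 0 + Gamma (\<nu> + 1) * bessel_ser \<nu> 0) (at_right 0)"
    unfolding W_def[abs_def] using assms by (intro tendsto_intros g M1) auto
  also have "0 * bessel_ser (\<nu> + 1) 0 + Gamma (\<nu> + 1) * bessel_ser \<nu> 0 = 1"
  proof -
    have "\<nu> + 1 \<notin> \<int>\<^sub>\<le>\<^sub>0" using assms by (auto simp: nonpos_Ints_def complex_eq_iff)
    thus ?thesis by (simp add: bessel_ser_0 rGamma_inverse_Gamma Gamma_eq_zero_iff)
  qed
  finally have "(W \<longlongrightarrow> 1) (at_right 0)" .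
  moreover have "(W \<longlongrightarrow> c) (at_right 0)"
    by (rule tendsto_eventually) (use eventually_at_right_less[of 0] in eventually_elim, use c in simp)
  ultimately have "c = 1" using tendsto_unique trivial_limit_at_right_real by blast
  thus ?thesis using c[OF assms(2)] by (simp add: W_def)
qed

section \<open>The integral representation of K\<close>

text \<open>The intended value is twice K.\<close>

definition bessel_cosh_integral :: "complex \<Rightarrow> real \<Rightarrow> complex" where
  "bessel_cosh_integral \<nu> x = (LINT t|lborel. exp (\<nu> * of_real t) * of_real (exp (- x * cosh t)))"

text \<open>The translation by ln (x / 2) balances the two exponentials: both get the coefficient x
  / 2. The factor 1 in \<open>1 * t\<close> matches the affine substitution rule.\<close>

lemma macdonald_integrand_cosh:
  assumes "x > 0"
  shows "macdonald_integrand \<nu> (x\<^sup>2 / 4) (ln (x / 2) + 1 * t)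
     = of_real (x / 2) powr \<nu> * (exp (\<nu> * of_real t) * of_real (exp (- x * cosh t)))"
proof -
  have e: "exp (ln (x / 2) + t) + x\<^sup>2 / 4 * exp (- (ln (x / 2) + t)) = x * cosh t"
    using assms by (simp add: exp_add exp_diff exp_minus cosh_def field_simps power2_eq_square)
  have "complex_of_real (x / 2) powr \<nu> = exp (\<nu> * of_real (ln (x / 2)))"
    using assms unfolding powr_def by (subst Ln_of_real) auto
  thus ?thesis unfolding macdonald_integrand_def mult_1 e exp_of_real[symmetric]
    by (simp add: algebra_simps flip: exp_add)
qed

lemma
  assumes "x > 0"
  shows bessel_cosh_integrable:
      "integrable lborel (\<lambda>t. exp (\<nu> * of_real t) * of_real (exp (- x * cosh t)))" (is ?A)
    and macdonald_integral_cosh: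
      "macdonald_integral \<nu> (x\<^sup>2 / 4) = of_real (x / 2) powr \<nu> * bessel_cosh_integral \<nu> x" (is ?B)
proof -
  have "integrable lborel (\<lambda>t. macdonald_integrand \<nu> (x\<^sup>2 / 4) (ln (x / 2) + 1 * t))"
    using assms by (intro lborel_integrable_real_affine macdonald_integrable) auto
  hence "integrable lborel (\<lambda>t. inverse (of_real (x / 2) powr \<nu>) *
      (of_real (x / 2) powr \<nu> * (exp (\<nu> * of_real t) * of_real (exp (- x * cosh t)))))"
    unfolding macdonald_integrand_cosh[OF assms] by (rule integrable_mult_right)
  thus ?A using assms by (simp flip: mult.assoc)
  show ?B unfolding macdonald_integral_def bessel_cosh_integral_def
    by (subst lborel_integral_real_affine[of 1 _ "ln (x / 2)"])
       (use assms in \<open>simp_all only: macdonald_integrand_cosh integral_mult_right_zero, simp_all\<close>)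
qed

lemma bessel_cosh_integral_minus: "bessel_cosh_integral (- \<nu>) x = bessel_cosh_integral \<nu> x"
  unfolding bessel_cosh_integral_def
  by (subst lborel_integral_real_affine[of "-1" _ 0]) auto

text \<open>By evenness, orders -\<nu> and 1 - \<nu> reduce to \<nu> and \<nu> - 1, leaving three
  integrals P, Q, R. The relations at \<nu> and -\<nu> yield \<open>e1\<close> and
  \<open>e2\<close>; in their difference \<open>e3\<close> eliminates Q and R, and P times the
  Wronskian remains.\<close>

lemma macdonald_quotient_eq:
  assumes x: "x > 0" and "\<bar>Re \<nu>\<bar> < 1" "\<nu> \<notin> \<int>"
  shows "macdonald_quotient \<nu> (of_real x) = bessel_cosh_integral \<nu> x / 2"
proof -
  define y where "y = x\<^sup>2 / 4"
  define p where "p = complex_of_real (x / 2) powr \<nu>"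
  define h where "h = complex_of_real (x / 2)"
  let ?P = "bessel_cosh_integral \<nu> x" and ?Q = "bessel_cosh_integral (\<nu> + 1) x" and ?R = "bessel_cosh_integral (\<nu> - 1) x"
  let ?g = "\<lambda>\<mu>. bessel_ser \<mu> (of_real y)"
  have y: "y > 0" and p: "p \<noteq> 0" and h: "h \<noteq> 0" and hy: "of_real y = h * h"
    using x by (auto simp: y_def p_def h_def power2_eq_square)
  have pw: "complex_of_real (x / 2) powr (- \<nu>) = inverse p" "complex_of_real (x / 2) powr (\<nu> + 1) = p * h"
    "complex_of_real (x / 2) powr (- \<nu> + 1) = inverse p * h" "complex_of_real (x / 2) powr (\<nu> - 1) = p / h"
    using x by (simp_all add: p_def h_def powr_minus powr_diff powr_add field_simps)
  have m: "macdonald_integral \<nu> y = p * ?P" "macdonald_integral (- \<nu>) y = inverse p * ?P"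
    "macdonald_integral (\<nu> + 1) y = p * h * ?Q" "macdonald_integral (- \<nu> + 1) y = inverse p * h * ?R"
    "macdonald_integral (\<nu> - 1) y = p / h * ?R"
    using bessel_cosh_integral_minus[of "\<nu> - 1" x] unfolding y_def macdonald_integral_cosh[OF x] pw
    by (simp_all add: bessel_cosh_integral_minus p_def)
  have "of_real y * (p * ?P) * ?g (\<nu> + 1) + p * h * ?Q * ?g \<nu> = 1"
    using macdonald_integral_bessel_ser[of \<nu> y] assms y by (simp add: m)
  \<comment> \<open>The relation at \<nu>, multiplied by the term of I at order -\<nu>;
    \<open>e2\<close> is the mirror image.\<close>
  hence e1: "inverse p * ?g (- \<nu>) = of_real y * ?P * ?g (\<nu> + 1) * ?g (- \<nu>) + h * ?Q * ?g \<nu> * ?g (- \<nu>)"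
    using p by (simp add: field_simps) algebra
  have "of_real y * (inverse p * ?P) * ?g (1 - \<nu>) + inverse p * h * ?R * ?g (- \<nu>) = 1"
    using macdonald_integral_bessel_ser[of "- \<nu>" y] assms y unfolding m by simp
  hence "p * ?g \<nu> = p * ?g \<nu> * (of_real y * (inverse p * ?P) * ?g (1 - \<nu>) + inverse p * h * ?R * ?g (- \<nu>))"
    by simp
  moreover have "p * (inverse p * z) = z" for z
    using p by simp
  ultimately have e2: "p * ?g \<nu> = of_real y * ?P * ?g (1 - \<nu>) * ?g \<nu> + h * ?R * ?g (- \<nu>) * ?g \<nu>"
    by (simp add: algebra_simps)
  have "\<nu> * (p * ?P) = p * h * ?Q - h * h * (p / h * ?R)"
    using macdonald_integral_rec[OF y, of \<nu>] by (simp only: m hy)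
  hence e3: "\<nu> * ?P = h * ?Q - h * ?R"
    using p h by (simp add: field_simps) algebra
  have s: "sin (\<nu> * of_real pi) \<noteq> 0"
    using assms(3) by (auto simp: sin_eq_0 mult.commute)
  have "bessel_I (- \<nu>) (of_real x) - bessel_I \<nu> (of_real x) = inverse p * ?g (- \<nu>) - p * ?g \<nu>"
    using assms unfolding y_def by (subst (1 2) bessel_I_eq) (auto simp: powr_minus p_def)
  also have "2 * \<dots> = ?P * (2 * of_real y * ?g (\<nu> + 1) * ?g (- \<nu>) - 2 * of_real y * ?g (1 - \<nu>) * ?g \<nu>
       + 2 * \<nu> * ?g \<nu> * ?g (- \<nu>))"
    using e1 e2 e3 by algebra
  also have "\<dots> = ?P * (2 * sin (of_real pi * \<nu>) / of_real pi)"
    using bessel_ser_wronskian[OF assms(2), of "of_real y"] by simp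
  finally show ?thesis
    using s unfolding macdonald_quotient_def by (simp add: field_simps)
qed

text \<open>Dominated convergence on the unit ball, where exp (Re \<nu> t) is at most exp t + exp
  (-t); the majorant is the sum of the cases \<nu> = 1 and \<nu> = -1.\<close>

lemma bessel_cosh_integral_tendsto:
  assumes x: "x > 0"
  shows "((\<lambda>\<nu>. bessel_cosh_integral \<nu> x) \<longlongrightarrow> bessel_cosh_integral 0 x) (at 0)"
proof -
  let ?f = "\<lambda>\<nu> t. exp (\<nu> * complex_of_real t) * of_real (exp (- x * cosh t))"
  have "((\<lambda>\<nu>. LINT t|lborel. ?f \<nu> t) \<longlongrightarrow> (LINT t|lborel. ?f 0 t)) (at 0 within ball 0 1)"
    unfolding tendsto_at_iff_sequentially o_def
  proof (intro allI impI)
    fix X assume X: "\<forall>i. X i \<in> ball 0 1 - {0::complex}" "X \<longlonglongrightarrow> 0"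
    show "(\<lambda>n. LINT t|lborel. ?f (X n) t) \<longlonglongrightarrow> (LINT t|lborel. ?f 0 t)"
    proof (rule integral_dominated_convergence)
      show "integrable lborel (\<lambda>t. norm (?f 1 t) + norm (?f (-1) t))"
        using bessel_cosh_integrable[OF x] by (intro Bochner_Integration.integrable_add integrable_norm)
      show "AE t in lborel. norm (?f (X n) t) \<le> norm (?f 1 t) + norm (?f (-1) t)" for n
      proof (intro AE_I2)
        fix t :: real
        have "\<bar>Re (X n)\<bar> \<le> 1" using spec[OF X(1), of n] abs_Re_le_cmod[of "X n"] by simp
        hence "\<bar>Re (X n)\<bar> * \<bar>t\<bar> \<le> 1 * \<bar>t\<bar>" by (intro mult_right_mono) auto
        hence "Re (X n) * t \<le> \<bar>t\<bar>" using abs_ge_self[of "Re (X n) * t"] by (simp add: abs_mult)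
        hence "exp (Re (X n) * t) \<le> exp \<bar>t\<bar>" by simp
        also have "\<dots> \<le> exp t + exp (- t)" by (simp add: abs_real_def)
        finally show "norm (?f (X n) t) \<le> norm (?f 1 t) + norm (?f (-1) t)"
          by (simp add: norm_mult flip: distrib_right)
      qed
      show "AE t in lborel. (\<lambda>n. ?f (X n) t) \<longlonglongrightarrow> ?f 0 t"
        by (intro AE_I2 tendsto_intros X)
    qed (rule borel_measurable_integrable[OF bessel_cosh_integrable[OF x]])+
  qed
  moreover have "at 0 within ball 0 1 = at (0::complex)" by (intro at_within_open) auto
  ultimately show ?thesis by (simp add: bessel_cosh_integral_def)
qed

text \<open>An imaginary order is an integer only at 0. There K is a limit, computed on the
  punctured unit disc, which contains no integer.\<close>

lemma bessel_K_imaginary: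
  assumes x: "x > 0"
  shows "bessel_K (\<i> * of_real \<mu>) (of_real x) = bessel_cosh_integral (\<i> * of_real \<mu>) x / 2"
proof (cases "\<mu> = 0")
  case False
  hence "\<i> * complex_of_real \<mu> \<notin> \<int>" by (auto simp: Ints_def complex_eq_iff)
  thus ?thesis using macdonald_quotient_eq[OF x, of "\<i> * of_real \<mu>"] by (simp add: bessel_K_def)
next
  case True
  have "((\<lambda>\<nu>. bessel_cosh_integral \<nu> x / 2) \<longlongrightarrow> bessel_cosh_integral 0 x / 2) (at 0)"
    by (intro tendsto_intros bessel_cosh_integral_tendsto x) simp
  moreover have "\<forall>\<^sub>F \<nu> in at 0. bessel_cosh_integral \<nu> x / 2 = macdonald_quotient \<nu> (of_real x)"
    unfolding eventually_at
  proof (intro exI[of _ 1] conjI ballI impI)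
    fix \<nu> :: complex assume n: "\<nu> \<noteq> 0 \<and> dist \<nu> 0 < 1"
    have "\<nu> \<notin> \<int>"
    proof
      assume "\<nu> \<in> \<int>"
      then obtain k where "\<nu> = of_int k" by (auto elim: Ints_cases)
      with n show False by auto
    qed
    moreover have "\<bar>Re \<nu>\<bar> < 1" using n abs_Re_le_cmod[of \<nu>] by simp
    ultimately show "bessel_cosh_integral \<nu> x / 2 = macdonald_quotient \<nu> (of_real x)"
      using macdonald_quotient_eq[OF x] by simp
  qed simp
  ultimately have "((\<lambda>\<nu>. macdonald_quotient \<nu> (of_real x)) \<longlongrightarrow> bessel_cosh_integral 0 x / 2) (at 0)"
    by (rule Lim_transform_eventually)
  thus ?thesis using True by (simp add: bessel_K_def tendsto_Lim)
qed

section \<open>Termwise integration of the Dirichlet series\<close>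

theorem theorem5:
  fixes a :: "nat \<Rightarrow> complex" and \<sigma> x l :: real and s :: complex
  assumes "\<And>w. Re w > \<sigma> \<Longrightarrow> summable (\<lambda>n. norm (dirichlet_term a w (Suc n)))"
    and "x > 0" and "l > 0" and "Re s > \<sigma>"
  shows "summable (\<lambda>n. a (Suc n) * bessel_K (\<i> * of_real (l * ln (real (Suc n)))) (of_real x)
                        * of_nat (Suc n) powr (- s))
       \<and> integrable lborel
           (\<lambda>t::real. dirichlet_series a (s + \<i> * of_real t) * of_real (exp (- x * cosh (t / l))))
       \<and> (\<Sum>n. a (Suc n) * bessel_K (\<i> * of_real (l * ln (real (Suc n)))) (of_real x)
                * of_nat (Suc n) powr (- s))
         = 1 / (2 * of_real l) *
           (LINT t|lborel. dirichlet_series a (s + \<i> * of_real t)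
                             * of_real (exp (- x * cosh (t / l))))"
proof -
  note l = \<open>l > 0\<close> and x = \<open>x > 0\<close>
  define E where "E t = complex_of_real (exp (- x * cosh (t / l)))" for t
  define f where "f n t = dirichlet_term a (s + \<i> * of_real t) (Suc n) * E t" for n t
  let ?K = "\<lambda>n. a (Suc n) * bessel_K (\<i> * of_real (l * ln (real (Suc n)))) (of_real x)
                        * of_nat (Suc n) powr (- s)"
  have term_split: "dirichlet_term a (s + \<i> * of_real t) (Suc n)
      = dirichlet_term a s (Suc n) * exp (- \<i> * of_real (ln (real (Suc n))) * of_real t)" for n t
    by (simp add: dirichlet_term_def powr_def Ln_of_nat algebra_simps exp_add exp_diff exp_minus del: of_nat_Suc)
       (simp add: divide_inverse del: of_nat_Suc)
  \<comment> \<open>Since n to the power -it has modulus 1, the bound splits into a factor in n and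
    a factor in t. Both summability conditions for exchanging sum and integral follow.\<close>
  have norm_f: "norm (f n t) = norm (dirichlet_term a s (Suc n)) * norm (E t)" for n t
    by (simp add: f_def term_split norm_mult del: of_nat_Suc)
  \<comment> \<open>The integrand is written in t / l so that l ln n becomes the order; the form
    \<open>0 + 1 / l * t\<close> fits the affine substitution rule.\<close>
  have rescale: "f n t = dirichlet_term a s (Suc n) *
       (exp (- (\<i> * of_real (l * ln (real (Suc n)))) * of_real (0 + 1 / l * t)) * of_real (exp (- x * cosh (0 + 1 / l * t))))" for n t
    using l by (simp add: f_def term_split E_def mult.assoc del: of_nat_Suc)
  have int_f: "integrable lborel (f n)" for n
    unfolding rescale
    by (intro integrable_mult_right lborel_integrable_real_affine[where f="\<lambda>t. exp (_ * of_real t) * of_real (exp (- x * cosh t))"] bessel_cosh_integrable x)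
       (use l in simp)
  have integral_f: "(LINT t|lborel. f n t) = 2 * of_real l * ?K n" for n
  proof -
    have "(LINT t|lborel. f n t) = dirichlet_term a s (Suc n) * (of_real l * bessel_cosh_integral (- (\<i> * of_real (l * ln (real (Suc n))))) x)"
      unfolding rescale integral_mult_right_zero bessel_cosh_integral_def
      using l by (subst (2) lborel_integral_real_affine[of "1 / l" _ 0]) (simp_all add: scaleR_conv_of_real del: of_nat_Suc)
    \<comment> \<open>The factor l is the Jacobian and 2 comes from the formula for K; evenness
      removes the minus sign in the order.\<close>
    also have "\<dots> = 2 * of_real l * ?K n"
      unfolding bessel_cosh_integral_minus bessel_K_imaginary[OF x] by (simp add: dirichlet_term_def del: of_nat_Suc)
    finally show ?thesis .
  qed
  have summ: "summable (\<lambda>n. norm (f n t))" for t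
    unfolding norm_f by (intro summable_mult2 assms)
  have summ_int: "summable (\<lambda>n. LINT t|lborel. norm (f n t))"
    unfolding norm_f using assms(1)[OF assms(4)] by (simp add: summable_mult2)
  have series: "(\<Sum>n. f n t) = dirichlet_series a (s + \<i> * of_real t) * E t" for t
    unfolding f_def dirichlet_series_def
    by (rule suminf_mult2 [symmetric], rule summable_norm_cancel, rule assms) (use assms in simp)
  have sums: "(\<lambda>n. LINT t|lborel. f n t) sums (LINT t|lborel. (\<Sum>n. f n t))"
    and int: "integrable lborel (\<lambda>t. \<Sum>n. f n t)"
    using summ summ_int int_f by (auto intro!: sums_integral integrable_suminf)
  have "(\<lambda>n. 1 / (2 * of_real l) * (2 * of_real l * ?K n)) sums (1 / (2 * of_real l) * (LINT t|lborel. (\<Sum>n. f n t)))"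
    using sums unfolding integral_f by (rule sums_mult)
  hence "?K sums (1 / (2 * of_real l) * (LINT t|lborel. (\<Sum>n. f n t)))"
    using l by (simp del: of_nat_Suc)
  with int show ?thesis
    unfolding series E_def by (simp add: sums_iff del: of_nat_Suc)
qed

end
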